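(* Let $M$ be a non-zero left $R$-module which is an S-IAD-module and assume that every $R$-submodule of $M$ that is fully coprime in $M$ is simple. (1) $\mathrm{Spec}^{\mathrm{fc}}(M)$ is countably compact (i.e. every open cover has a countable subcover) if and only if $\mathcal{S}(M)$ is countable. (2) $\mathrm{Spec}^{\mathrm{fc}}(M)$ is compact if and only if $\mathcal{S}(M)$ is finite.
   Context: $R$ is an associative (not necessarily commutative) ring with $1_R\neq 0_R$ and modules are unital left $R$-modules; $L\leq_R M$ means that $L$ is an $R$-submodule of $M$. A submodule $L\leq_R M$ is fully invariant if $f(L)\subseteq L$ for every $R$-linear endomorphism $f$ of $M$; $M$ is duo if every $R$-submodule of $M$ is fully invariant. $M$ is self-injective if for every $N\leq_R M$ every $R$-linear map $N\to M$ extends to an endomorphism of $M$. $M$ is atomic if every non-zero submodule of $M$ contains a simple submodule. An S-IAD-module is a module that is self-injective, atomic and duo. $\mathcal{S}(M)$ is the set of simple submodules of $M$. For $X,Y\leq_R M$ put $\mathrm{An}(X)=\{f\in \mathrm{End}_R(M)\mid f(X)=0\}$ and $X\odot_M Y=\bigcap_{f\in\mathrm{An}(X)} f^{-1}(Y)$. A non-zero fully invariant submodule $K$ of $M$ is fully coprime in $M$ if for all fully invariant submodules $X,Y$ of $M$: $K\subseteq X\odot_M Y$ implies $K\subseteq X$ or $K\subseteq Y$. $\mathrm{Spec}^{\mathrm{fc}}(M)$ is the set of all non-zero fully invariant submodules of $M$ that are fully coprime in $M$. For $M$ duo, $\mathrm{Spec}^{\mathrm{fc}}(M)$ carries the topology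 whose closed sets are $\mathcal{V}^{\mathrm{fc}}(L)=\{K\in\mathrm{Spec}^{\mathrm{fc}}(M)\mid K\subseteq L\}$, $L\leq_R M$. Convention: a space is compact if every open cover has a finite subcover (no Hausdorff condition), and countably compact (also called Lindelöf) if every open cover has a countable subcover. Countable sets may be finite. *)

theory Defs
  imports "HOL-Analysis.Analysis" "HOL-Algebra.Module"
begin

text \<open>
  The locale \<open>module\<close> of HOL-Algebra requires a commutative ring of scalars. The following locale
  has the same module axioms over an arbitrary ring with \<open>1 \<noteq> 0\<close>; the record type of modules
  and the predicate \<^locale>\<open>submodule\<close>, which do not need commutativity, are those of HOL-Algebra.
\<close>

locale left_module = R?: ring R + M?: abelian_group M for R (structure) and M (structure) +
  assumes one_not_zero: "\<one> \<noteq> \<zero>"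
    and smult_closed: "\<lbrakk>a \<in> carrier R; x \<in> carrier M\<rbrakk> \<Longrightarrow> a \<odot>\<^bsub>M\<^esub> x \<in> carrier M"
    and smult_l_distr: "\<lbrakk>a \<in> carrier R; b \<in> carrier R; x \<in> carrier M\<rbrakk> \<Longrightarrow>
      (a \<oplus> b) \<odot>\<^bsub>M\<^esub> x = a \<odot>\<^bsub>M\<^esub> x \<oplus>\<^bsub>M\<^esub> b \<odot>\<^bsub>M\<^esub> x"
    and smult_r_distr: "\<lbrakk>a \<in> carrier R; x \<in> carrier M; y \<in> carrier M\<rbrakk> \<Longrightarrow>
      a \<odot>\<^bsub>M\<^esub> (x \<oplus>\<^bsub>M\<^esub> y) = a \<odot>\<^bsub>M\<^esub> x \<oplus>\<^bsub>M\<^esub> a \<odot>\<^bsub>M\<^esub> y"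
    and smult_assoc1: "\<lbrakk>a \<in> carrier R; b \<in> carrier R; x \<in> carrier M\<rbrakk> \<Longrightarrow>
      (a \<otimes> b) \<odot>\<^bsub>M\<^esub> x = a \<odot>\<^bsub>M\<^esub> (b \<odot>\<^bsub>M\<^esub> x)"
    and smult_one: "x \<in> carrier M \<Longrightarrow> \<one> \<odot>\<^bsub>M\<^esub> x = x"

text \<open>
  As for \<^const>\<open>hom\<close>, the values of a linear map outside the carrier are arbitrary; nothing below
  depends on them.
\<close>

definition linear_maps ::
    "('r, 'a) ring_scheme \<Rightarrow> ('r, 'm, 'b) module_scheme \<Rightarrow> ('r, 'n, 'c) module_scheme \<Rightarrow> ('m \<Rightarrow> 'n) set"
  where "linear_maps R M N =
    {f \<in> hom (add_monoid M) (add_monoid N).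
      \<forall>a\<in>carrier R. \<forall>x\<in>carrier M. f (a \<odot>\<^bsub>M\<^esub> x) = a \<odot>\<^bsub>N\<^esub> f x}"

abbreviation End_mod :: "('r, 'a) ring_scheme \<Rightarrow> ('r, 'm, 'b) module_scheme \<Rightarrow> ('m \<Rightarrow> 'm) set"
  where "End_mod R M \<equiv> linear_maps R M M"

definition fully_invariant ::
    "('r, 'a) ring_scheme \<Rightarrow> ('r, 'm, 'b) module_scheme \<Rightarrow> 'm set \<Rightarrow> bool"
  where "fully_invariant R M L \<longleftrightarrow> submodule L R M \<and> (\<forall>f\<in>End_mod R M. f ` L \<subseteq> L)"

definition duo :: "('r, 'a) ring_scheme \<Rightarrow> ('r, 'm, 'b) module_scheme \<Rightarrow> bool"
  where "duo R M \<longleftrightarrow> (\<forall>L. submodule L R M \<longrightarrow> fully_invariant R M L)"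

definition self_injective :: "('r, 'a) ring_scheme \<Rightarrow> ('r, 'm, 'b) module_scheme \<Rightarrow> bool"
  where "self_injective R M \<longleftrightarrow>
    (\<forall>N. submodule N R M \<longrightarrow>
      (\<forall>g\<in>linear_maps R (M\<lparr>carrier := N\<rparr>) M. \<exists>f\<in>End_mod R M. \<forall>x\<in>N. f x = g x))"

definition simple_submodules ::
    "('r, 'a) ring_scheme \<Rightarrow> ('r, 'm, 'b) module_scheme \<Rightarrow> 'm set set"
  where "simple_submodules R M =
    {S. submodule S R M \<and> S \<noteq> {\<zero>\<^bsub>M\<^esub>} \<and>
        (\<forall>L. submodule L R M \<and> L \<subseteq> S \<longrightarrow> L = {\<zero>\<^bsub>M\<^esub>} \<or> L = S)}"

definition atomic_module :: "('r, 'a) ring_scheme \<Rightarrow> ('r, 'm, 'b) module_scheme \<Rightarrow> bool"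
  where "atomic_module R M \<longleftrightarrow>
    (\<forall>L. submodule L R M \<and> L \<noteq> {\<zero>\<^bsub>M\<^esub>} \<longrightarrow> (\<exists>S\<in>simple_submodules R M. S \<subseteq> L))"

definition S_IAD :: "('r, 'a) ring_scheme \<Rightarrow> ('r, 'm, 'b) module_scheme \<Rightarrow> bool"
  where "S_IAD R M \<longleftrightarrow> self_injective R M \<and> atomic_module R M \<and> duo R M"

definition An :: "('r, 'a) ring_scheme \<Rightarrow> ('r, 'm, 'b) module_scheme \<Rightarrow> 'm set \<Rightarrow> ('m \<Rightarrow> 'm) set"
  where "An R M X = {f \<in> End_mod R M. \<forall>x\<in>X. f x = \<zero>\<^bsub>M\<^esub>}"

definition coprod ::
    "('r, 'a) ring_scheme \<Rightarrow> ('r, 'm, 'b) module_scheme \<Rightarrow> 'm set \<Rightarrow> 'm set \<Rightarrow> 'm set"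
  where "coprod R M X Y = (\<Inter>f\<in>An R M X. {x \<in> carrier M. f x \<in> Y})"

definition fully_coprime ::
    "('r, 'a) ring_scheme \<Rightarrow> ('r, 'm, 'b) module_scheme \<Rightarrow> 'm set \<Rightarrow> bool"
  where "fully_coprime R M K \<longleftrightarrow>
    fully_invariant R M K \<and> K \<noteq> {\<zero>\<^bsub>M\<^esub>} \<and>
    (\<forall>X Y. fully_invariant R M X \<and> fully_invariant R M Y \<and> K \<subseteq> coprod R M X Y
       \<longrightarrow> K \<subseteq> X \<or> K \<subseteq> Y)"

definition Spec_fc :: "('r, 'a) ring_scheme \<Rightarrow> ('r, 'm, 'b) module_scheme \<Rightarrow> 'm set set"
  where "Spec_fc R M = {K. fully_coprime R M K}"

definition V_fc :: "('r, 'a) ring_scheme \<Rightarrow> ('r, 'm, 'b) module_scheme \<Rightarrow> 'm set \<Rightarrow> 'm set set"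
  where "V_fc R M L = {K \<in> Spec_fc R M. K \<subseteq> L}"

text \<open>
  The sets \<^term>\<open>V_fc R M L\<close> need not be the closed sets of a topology unless \<open>M\<close> is duo, and
  \<^const>\<open>topology\<close> is only meaningful in that case; see \<open>closedin_Spec_fc_topology\<close> below.
\<close>

definition Spec_fc_topology ::
    "('r, 'a) ring_scheme \<Rightarrow> ('r, 'm, 'b) module_scheme \<Rightarrow> 'm set topology"
  where "Spec_fc_topology R M =
    topology (\<lambda>U. \<exists>L. submodule L R M \<and> U = Spec_fc R M - V_fc R M L)"

context left_module
begin

lemma submodule_iff:
  "submodule H R M \<longleftrightarrow> H \<subseteq> carrier M \<and> \<zero>\<^bsub>M\<^esub> \<in> H \<and> (\<forall>x\<in>H. \<ominus>\<^bsub>M\<^esub> x \<in> H) \<and>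
    (\<forall>x\<in>H. \<forall>y\<in>H. x \<oplus>\<^bsub>M\<^esub> y \<in> H) \<and> (\<forall>a\<in>carrier R. \<forall>x\<in>H. a \<odot>\<^bsub>M\<^esub> x \<in> H)"
  by (auto simp: submodule_def subgroup_def submodule_axioms_def a_inv_def)

lemma smult_zero:
  assumes "a \<in> carrier R" shows "a \<odot>\<^bsub>M\<^esub> \<zero>\<^bsub>M\<^esub> = \<zero>\<^bsub>M\<^esub>"
proof -
  have "a \<odot>\<^bsub>M\<^esub> \<zero>\<^bsub>M\<^esub> \<oplus>\<^bsub>M\<^esub> a \<odot>\<^bsub>M\<^esub> \<zero>\<^bsub>M\<^esub> = a \<odot>\<^bsub>M\<^esub> \<zero>\<^bsub>M\<^esub>"
    using smult_r_distr[OF assms, of "\<zero>\<^bsub>M\<^esub>" "\<zero>\<^bsub>M\<^esub>"] by simp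
  then show ?thesis
    using smult_closed[OF assms M.zero_closed] by (metis M.add.r_cancel_one')
qed

lemma submodule_zero: "submodule {\<zero>\<^bsub>M\<^esub>} R M"
  by (simp add: submodule_iff smult_zero)

lemma submodule_carrier: "submodule (carrier M) R M"
  by (simp add: submodule_iff smult_closed)

lemma submodule_Inter:
  assumes "\<And>L. L \<in> \<L> \<Longrightarrow> submodule L R M"
  shows "submodule (carrier M \<inter> \<Inter>\<L>) R M"
  using assms unfolding submodule_iff by (auto simp: smult_closed)

lemma submodule_coprod:
  assumes "submodule Y R M" shows "submodule (coprod R M X Y) R M"
proof -
  have "submodule {x \<in> carrier M. f x \<in> Y} R M" if f: "f \<in> End_mod R M" for f
  proof -
    have cl: "f x \<in> carrier M" if "x \<in> carrier M" for x
      using f that by (auto simp: linear_maps_def hom_def)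
    have add: "f (x \<oplus>\<^bsub>M\<^esub> y) = f x \<oplus>\<^bsub>M\<^esub> f y" if "x \<in> carrier M" "y \<in> carrier M" for x y
      using f that by (auto simp: linear_maps_def hom_def)
    have sm: "f (a \<odot>\<^bsub>M\<^esub> x) = a \<odot>\<^bsub>M\<^esub> f x" if "a \<in> carrier R" "x \<in> carrier M" for a x
      using f that by (auto simp: linear_maps_def)
    have z: "f \<zero>\<^bsub>M\<^esub> = \<zero>\<^bsub>M\<^esub>"
      using add[of "\<zero>\<^bsub>M\<^esub>" "\<zero>\<^bsub>M\<^esub>"] cl[of "\<zero>\<^bsub>M\<^esub>"]
      by (metis M.add.r_cancel_one' M.l_zero M.zero_closed)
    have neg: "f (\<ominus>\<^bsub>M\<^esub> x) = \<ominus>\<^bsub>M\<^esub> f x" if "x \<in> carrier M" for x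
      using add[of "\<ominus>\<^bsub>M\<^esub> x" x] z cl that by (metis M.a_inv_closed M.l_neg M.minus_equality)
    show ?thesis
      using assms unfolding submodule_iff by (auto simp: add sm z neg smult_closed)
  qed
  moreover have "coprod R M X Y =
      carrier M \<inter> \<Inter>((\<lambda>f. {x \<in> carrier M. f x \<in> Y}) ` An R M X)"
  proof -
    have "(\<lambda>_. \<zero>\<^bsub>M\<^esub>) \<in> An R M X"
      by (auto simp: An_def linear_maps_def hom_def smult_zero)
    then show ?thesis unfolding coprod_def by blast
  qed
  ultimately show ?thesis
    using submodule_Inter[of "(\<lambda>f. {x \<in> carrier M. f x \<in> Y}) ` An R M X"]
    by (auto simp: An_def)
qed

lemma V_fc_Un:
  assumes "duo R M" "submodule X R M" "submodule Y R M"
  shows "V_fc R M X \<union> V_fc R M Y = V_fc R M (coprod R M X Y)"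
proof -
  have X: "fully_invariant R M X" and Y: "fully_invariant R M Y"
    using assms by (auto simp: duo_def)
  have "X \<subseteq> coprod R M X Y"
    using assms(2,3) by (auto simp: coprod_def An_def submodule_iff)
  moreover have "Y \<subseteq> coprod R M X Y"
    using Y assms(3) by (fastforce simp: coprod_def An_def submodule_iff fully_invariant_def)
  ultimately show ?thesis
    using X Y unfolding V_fc_def Spec_fc_def fully_coprime_def by blast
qed

lemma V_fc_Inter:
  "V_fc R M (carrier M \<inter> \<Inter>\<L>) = Spec_fc R M \<inter> (\<Inter>L\<in>\<L>. V_fc R M L)"
  by (auto simp: V_fc_def Spec_fc_def fully_coprime_def fully_invariant_def submodule_iff)

lemma istopology_Spec_fc:
  assumes "duo R M"
  shows "istopology (\<lambda>U. \<exists>L. submodule L R M \<and> U = Spec_fc R M - V_fc R M L)"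
    (is "istopology ?op")
  unfolding istopology_def
proof (intro conjI allI impI)
  fix S T assume "?op S" "?op T"
  then obtain X Y where X: "submodule X R M" "S = Spec_fc R M - V_fc R M X"
    and Y: "submodule Y R M" "T = Spec_fc R M - V_fc R M Y" by blast
  have "S \<inter> T = Spec_fc R M - V_fc R M (coprod R M X Y)"
    using X Y V_fc_Un[OF assms X(1) Y(1)] by blast
  then show "?op (S \<inter> T)" using submodule_coprod[OF Y(1)] by blast
next
  fix \<K> assume "\<forall>K\<in>\<K>. ?op K"
  then obtain L where L: "\<And>K. K \<in> \<K> \<Longrightarrow> submodule (L K) R M \<and> K = Spec_fc R M - V_fc R M (L K)"
    by metis
  have "\<Union>\<K> = Spec_fc R M - V_fc R M (carrier M \<inter> \<Inter>(L ` \<K>))"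
    unfolding V_fc_Inter using L by blast
  moreover have "submodule (carrier M \<inter> \<Inter>(L ` \<K>)) R M"
    using L by (intro submodule_Inter) auto
  ultimately show "?op (\<Union>\<K>)" by blast
qed

lemma openin_Spec_fc_topology:
  assumes "duo R M"
  shows "openin (Spec_fc_topology R M) U \<longleftrightarrow>
    (\<exists>L. submodule L R M \<and> U = Spec_fc R M - V_fc R M L)"
  unfolding Spec_fc_topology_def by (simp add: topology_inverse'[OF istopology_Spec_fc[OF assms]])

lemma topspace_Spec_fc_topology:
  assumes "duo R M" shows "topspace (Spec_fc_topology R M) = Spec_fc R M"
proof -
  have "V_fc R M {\<zero>\<^bsub>M\<^esub>} = {}"
    by (auto simp: V_fc_def Spec_fc_def fully_coprime_def fully_invariant_def submodule_iff)
  then have "openin (Spec_fc_topology R M) (Spec_fc R M)"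
    using submodule_zero unfolding openin_Spec_fc_topology[OF assms] by (metis Diff_empty)
  then show ?thesis
    by (metis Diff_subset openin_Spec_fc_topology[OF assms] openin_subset openin_topspace subset_antisym)
qed

theorem closedin_Spec_fc_topology:
  assumes "duo R M"
  shows "closedin (Spec_fc_topology R M) C \<longleftrightarrow> (\<exists>L. submodule L R M \<and> C = V_fc R M L)"
proof -
  have "V_fc R M L \<subseteq> Spec_fc R M" for L by (auto simp: V_fc_def)
  then show ?thesis
    unfolding closedin_def topspace_Spec_fc_topology[OF assms] openin_Spec_fc_topology[OF assms]
    by (metis double_diff order_refl)
qed

end

end

theory Submission
  imports Defs "HOL-Algebra.AbelCoset"
begin

text \<open>
  The hypotheses force the topology to be discrete on the set of simple submodules, and a discrete
  space is compact (Lindelof) exactly when it is finite (countable).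

  Everything rests on one use of self-injectivity: if \<open>X \<inter> Y = 0\<close>, then the projection
  \<open>X \<oplus> Y \<rightarrow> Y\<close> extends to an endomorphism \<open>f\<close> of \<open>M\<close>, which kills \<open>X\<close> and fixes \<open>Y\<close>
  pointwise (\<open>self_injective_extends_projection\<close>). This is applied twice.

  First, every simple submodule \<open>K\<close> is fully coprime (\<open>simple_fully_coprime\<close>): if \<open>K\<close> is not
  contained in \<open>X\<close>, then \<open>X \<inter> K = 0\<close>, and the resulting \<open>f \<in> An(X)\<close> is the identity on \<open>K\<close>, so
  that \<open>K \<subseteq> X \<odot> Y\<close> implies \<open>K = f(K) \<subseteq> Y\<close>. The converse being a hypothesis, the points of
  the spectrum are precisely the simple submodules.

  Second, every point is open (\<open>simple_excluded_by_submodule\<close>). A submodule \<open>L\<close> that is maximal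
  with \<open>L \<inter> K = 0\<close> contains all simple submodules \<open>S \<noteq> K\<close>: otherwise \<open>K\<close> would lie in \<open>L \<oplus> S\<close>,
  and the extended projection onto \<open>S\<close> would map \<open>K\<close> into \<open>S\<close>. Since \<open>M\<close> is duo, it also maps
  \<open>K\<close> into itself, hence it vanishes on \<open>K\<close>; but its kernel in \<open>L \<oplus> S\<close> is \<open>L\<close>. So the closed
  set defined by \<open>L\<close> is the complement of the point \<open>K\<close>.
\<close>

lemma Lindelof_space_discrete_topology:
  "Lindelof_space (discrete_topology X) \<longleftrightarrow> countable X"
proof
  assume "Lindelof_space (discrete_topology X)"
  moreover have "\<Union>((\<lambda>x. {x}) ` X) = X" by blast
  ultimately obtain \<V> where V: "countable \<V>" "\<V> \<subseteq> (\<lambda>x. {x}) ` X" "\<Union>\<V> = X"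
    unfolding Lindelof_space_def by (force dest: spec[of _ "(\<lambda>x. {x}) ` X"])
  then have "countable (\<Union>\<V>)"
    using countable_UN[of \<V> "\<lambda>v. v"] by auto
  then show "countable X" using V(3) by simp
qed (simp add: countable_imp_Lindelof_space)

context left_module
begin

lemma submodule_set_add:
  assumes "submodule X R M" "submodule Y R M"
  shows "submodule (X <+>\<^bsub>M\<^esub> Y) R M"
proof -
  have cl: "x \<in> carrier M" if "x \<in> X \<or> x \<in> Y" for x
    using assms that by (auto simp: submodule_iff)
  have "\<zero>\<^bsub>M\<^esub> = \<zero>\<^bsub>M\<^esub> \<oplus>\<^bsub>M\<^esub> \<zero>\<^bsub>M\<^esub>" by simp
  moreover have "\<zero>\<^bsub>M\<^esub> \<in> X" "\<zero>\<^bsub>M\<^esub> \<in> Y" using assms by (simp_all add: submodule_iff)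
  ultimately have z: "\<zero>\<^bsub>M\<^esub> \<in> X <+>\<^bsub>M\<^esub> Y" unfolding set_add_def' by blast
  have add: "u \<oplus>\<^bsub>M\<^esub> v \<in> X <+>\<^bsub>M\<^esub> Y" if uv: "u \<in> X <+>\<^bsub>M\<^esub> Y" "v \<in> X <+>\<^bsub>M\<^esub> Y" for u v
  proof -
    obtain x y x' y' where *: "x \<in> X" "y \<in> Y" "u = x \<oplus>\<^bsub>M\<^esub> y" "x' \<in> X" "y' \<in> Y" "v = x' \<oplus>\<^bsub>M\<^esub> y'"
      using uv by (auto simp: set_add_def')
    then have "u \<oplus>\<^bsub>M\<^esub> v = (x \<oplus>\<^bsub>M\<^esub> x') \<oplus>\<^bsub>M\<^esub> (y \<oplus>\<^bsub>M\<^esub> y')"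
      using cl by (simp add: M.a_ac)
    moreover have "x \<oplus>\<^bsub>M\<^esub> x' \<in> X" "y \<oplus>\<^bsub>M\<^esub> y' \<in> Y"
      using * assms by (auto simp: submodule_iff)
    ultimately show ?thesis by (auto simp: set_add_def')
  qed
  have neg: "\<ominus>\<^bsub>M\<^esub> u \<in> X <+>\<^bsub>M\<^esub> Y" if u: "u \<in> X <+>\<^bsub>M\<^esub> Y" for u
  proof -
    obtain x y where *: "x \<in> X" "y \<in> Y" "u = x \<oplus>\<^bsub>M\<^esub> y"
      using u by (auto simp: set_add_def')
    then have "\<ominus>\<^bsub>M\<^esub> u = \<ominus>\<^bsub>M\<^esub> x \<oplus>\<^bsub>M\<^esub> \<ominus>\<^bsub>M\<^esub> y"
      using cl by (simp add: M.minus_add)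
    moreover have "\<ominus>\<^bsub>M\<^esub> x \<in> X" "\<ominus>\<^bsub>M\<^esub> y \<in> Y"
      using * assms by (auto simp: submodule_iff)
    ultimately show ?thesis by (auto simp: set_add_def')
  qed
  have sm: "a \<odot>\<^bsub>M\<^esub> u \<in> X <+>\<^bsub>M\<^esub> Y" if a: "a \<in> carrier R" and u: "u \<in> X <+>\<^bsub>M\<^esub> Y" for a u
  proof -
    obtain x y where *: "x \<in> X" "y \<in> Y" "u = x \<oplus>\<^bsub>M\<^esub> y"
      using u by (auto simp: set_add_def')
    then have "a \<odot>\<^bsub>M\<^esub> u = a \<odot>\<^bsub>M\<^esub> x \<oplus>\<^bsub>M\<^esub> a \<odot>\<^bsub>M\<^esub> y"
      using cl a by (simp add: smult_r_distr)
    moreover have "a \<odot>\<^bsub>M\<^esub> x \<in> X" "a \<odot>\<^bsub>M\<^esub> y \<in> Y"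
      using * a assms by (auto simp: submodule_iff)
    ultimately show ?thesis by (auto simp: set_add_def')
  qed
  show ?thesis
    unfolding submodule_iff
  proof (intro conjI ballI)
    show "X <+>\<^bsub>M\<^esub> Y \<subseteq> carrier M" using cl by (auto simp: set_add_def')
  qed (use z add neg sm in blast)+
qed

lemma submodule_Int:
  assumes "submodule X R M" "submodule Y R M"
  shows "submodule (X \<inter> Y) R M"
  using assms by (auto simp: submodule_iff)

lemma subset_set_add:
  assumes "submodule X R M" "submodule Y R M"
  shows "X \<subseteq> X <+>\<^bsub>M\<^esub> Y" "Y \<subseteq> X <+>\<^bsub>M\<^esub> Y"
proof -
  have cl: "x \<in> carrier M" if "x \<in> X \<or> x \<in> Y" for x
    using assms that by (auto simp: submodule_iff)
  have z: "\<zero>\<^bsub>M\<^esub> \<in> X" "\<zero>\<^bsub>M\<^esub> \<in> Y"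
    using assms by (auto simp: submodule_iff)
  show "X \<subseteq> X <+>\<^bsub>M\<^esub> Y"
  proof
    fix x assume "x \<in> X"
    then have "x = x \<oplus>\<^bsub>M\<^esub> \<zero>\<^bsub>M\<^esub>" using cl by simp
    with \<open>x \<in> X\<close> z show "x \<in> X <+>\<^bsub>M\<^esub> Y" unfolding set_add_def' by blast
  qed
  show "Y \<subseteq> X <+>\<^bsub>M\<^esub> Y"
  proof
    fix y assume "y \<in> Y"
    then have "y = \<zero>\<^bsub>M\<^esub> \<oplus>\<^bsub>M\<^esub> y" using cl by simp
    with \<open>y \<in> Y\<close> z show "y \<in> X <+>\<^bsub>M\<^esub> Y" unfolding set_add_def' by blast
  qed
qed

lemma direct_sum_decomposition_unique:
  assumes "submodule X R M" "submodule Y R M" "X \<inter> Y = {\<zero>\<^bsub>M\<^esub>}"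
    and mem: "x \<in> X" "x' \<in> X" "y \<in> Y" "y' \<in> Y"
    and eq: "x \<oplus>\<^bsub>M\<^esub> y = x' \<oplus>\<^bsub>M\<^esub> y'"
  shows "y = y'"
proof -
  have cl: "x \<in> carrier M" "x' \<in> carrier M" "y \<in> carrier M" "y' \<in> carrier M"
    using assms by (auto simp: submodule_iff)
  let ?d = "y \<oplus>\<^bsub>M\<^esub> \<ominus>\<^bsub>M\<^esub> y'"
  have "?d = \<ominus>\<^bsub>M\<^esub> x \<oplus>\<^bsub>M\<^esub> (x \<oplus>\<^bsub>M\<^esub> y) \<oplus>\<^bsub>M\<^esub> \<ominus>\<^bsub>M\<^esub> y'"
    using cl by (simp add: M.r_neg1)
  also have "\<dots> = \<ominus>\<^bsub>M\<^esub> x \<oplus>\<^bsub>M\<^esub> (x' \<oplus>\<^bsub>M\<^esub> y') \<oplus>\<^bsub>M\<^esub> \<ominus>\<^bsub>M\<^esub> y'"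
    using eq by simp
  also have "\<dots> = \<ominus>\<^bsub>M\<^esub> x \<oplus>\<^bsub>M\<^esub> x'"
    using cl by (simp add: M.a_assoc M.r_neg)
  finally have "?d \<in> X"
    using assms(1) mem by (simp add: submodule_iff)
  moreover have "?d \<in> Y"
    using assms(2) mem by (simp add: submodule_iff)
  ultimately have "?d = \<zero>\<^bsub>M\<^esub>" using assms(3) by blast
  then show ?thesis
    using cl by (metis M.minus_equality M.minus_minus M.a_inv_closed)
qed

text \<open>
  The projection of the internal direct sum \<open>X \<oplus> Y\<close> onto \<open>Y\<close> is a well-defined linear map because
  the decomposition is unique; self-injectivity extends it to all of \<open>M\<close>.
\<close>

lemma self_injective_extends_projection:
  assumes inj: "self_injective R M"
    and X: "submodule X R M" and Y: "submodule Y R M" and disj: "X \<inter> Y = {\<zero>\<^bsub>M\<^esub>}"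
  obtains f where "f \<in> End_mod R M" "\<And>x. x \<in> X \<Longrightarrow> f x = \<zero>\<^bsub>M\<^esub>" "\<And>y. y \<in> Y \<Longrightarrow> f y = y"
    "\<And>x y. x \<in> X \<Longrightarrow> y \<in> Y \<Longrightarrow> f (x \<oplus>\<^bsub>M\<^esub> y) = y"
proof -
  define p where "p z = (THE y. y \<in> Y \<and> (\<exists>x\<in>X. z = x \<oplus>\<^bsub>M\<^esub> y))" for z
  have p: "p (x \<oplus>\<^bsub>M\<^esub> y) = y" if "x \<in> X" "y \<in> Y" for x y
    unfolding p_def using that direct_sum_decomposition_unique[OF X Y disj]
    by (intro the_equality) blast+
  have cl: "x \<in> carrier M" if "x \<in> X \<or> x \<in> Y" for x
    using X Y that by (auto simp: submodule_iff)
  have "p \<in> linear_maps R (M\<lparr>carrier := X <+>\<^bsub>M\<^esub> Y\<rparr>) M"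
  proof -
    have "p z \<in> carrier M" if "z \<in> X <+>\<^bsub>M\<^esub> Y" for z
      using that p cl by (auto simp: set_add_def')
    moreover have "p (u \<oplus>\<^bsub>M\<^esub> v) = p u \<oplus>\<^bsub>M\<^esub> p v"
      if uv: "u \<in> X <+>\<^bsub>M\<^esub> Y" "v \<in> X <+>\<^bsub>M\<^esub> Y" for u v
    proof -
      obtain x y x' y' where *: "x \<in> X" "y \<in> Y" "u = x \<oplus>\<^bsub>M\<^esub> y"
          "x' \<in> X" "y' \<in> Y" "v = x' \<oplus>\<^bsub>M\<^esub> y'"
        using uv by (auto simp: set_add_def')
      then have "u \<oplus>\<^bsub>M\<^esub> v = (x \<oplus>\<^bsub>M\<^esub> x') \<oplus>\<^bsub>M\<^esub> (y \<oplus>\<^bsub>M\<^esub> y')"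
        using cl by (simp add: M.a_ac)
      moreover have "x \<oplus>\<^bsub>M\<^esub> x' \<in> X" "y \<oplus>\<^bsub>M\<^esub> y' \<in> Y"
        using * X Y by (auto simp: submodule_iff)
      ultimately show ?thesis using * p by simp
    qed
    moreover have "p (a \<odot>\<^bsub>M\<^esub> u) = a \<odot>\<^bsub>M\<^esub> p u"
      if a: "a \<in> carrier R" and u: "u \<in> X <+>\<^bsub>M\<^esub> Y" for a u
    proof -
      obtain x y where *: "x \<in> X" "y \<in> Y" "u = x \<oplus>\<^bsub>M\<^esub> y"
        using u by (auto simp: set_add_def')
      then have "a \<odot>\<^bsub>M\<^esub> u = a \<odot>\<^bsub>M\<^esub> x \<oplus>\<^bsub>M\<^esub> a \<odot>\<^bsub>M\<^esub> y"
        using cl a by (simp add: smult_r_distr)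
      moreover have "a \<odot>\<^bsub>M\<^esub> x \<in> X" "a \<odot>\<^bsub>M\<^esub> y \<in> Y"
        using * a X Y by (auto simp: submodule_iff)
      ultimately show ?thesis using * p by simp
    qed
    ultimately show ?thesis
      by (auto simp: linear_maps_def hom_def)
  qed
  then obtain f where f: "f \<in> End_mod R M" and fp: "\<And>z. z \<in> X <+>\<^bsub>M\<^esub> Y \<Longrightarrow> f z = p z"
    using inj submodule_set_add[OF X Y] unfolding self_injective_def by blast
  have sum: "f (x \<oplus>\<^bsub>M\<^esub> y) = y" if "x \<in> X" "y \<in> Y" for x y
  proof -
    have "x \<oplus>\<^bsub>M\<^esub> y \<in> X <+>\<^bsub>M\<^esub> Y" using that by (auto simp: set_add_def')
    then show ?thesis using fp p that by simp
  qed
  have z: "\<zero>\<^bsub>M\<^esub> \<in> X" "\<zero>\<^bsub>M\<^esub> \<in> Y"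
    using X Y by (auto simp: submodule_iff)
  show ?thesis
  proof
    show "f \<in> End_mod R M" by (fact f)
    show "f x = \<zero>\<^bsub>M\<^esub>" if "x \<in> X" for x using sum[OF that z(2)] cl that by simp
    show "f y = y" if "y \<in> Y" for y using sum[OF z(1) that] cl that by simp
  qed (fact sum)
qed

lemma simple_disjoint_or_subset:
  assumes "K \<in> simple_submodules R M" "submodule X R M"
  shows "X \<inter> K = {\<zero>\<^bsub>M\<^esub>} \<or> K \<subseteq> X"
proof -
  have "X \<inter> K = {\<zero>\<^bsub>M\<^esub>} \<or> X \<inter> K = K"
    using assms submodule_Int[of X K] by (auto simp: simple_submodules_def)
  then show ?thesis by blast
qed

text \<open>
  A simple \<open>K\<close> not contained in \<open>X\<close> meets it trivially, so some endomorphism annihilates \<open>X\<close> and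
  fixes \<open>K\<close>; this single element of \<open>An(X)\<close> already forces \<open>K \<subseteq> Y\<close>.
\<close>

lemma simple_fully_coprime:
  assumes inj: "self_injective R M" and duo: "duo R M" and K: "K \<in> simple_submodules R M"
  shows "fully_coprime R M K"
  unfolding fully_coprime_def
proof (intro conjI allI impI)
  have Ks: "submodule K R M" and "K \<noteq> {\<zero>\<^bsub>M\<^esub>}" using K by (auto simp: simple_submodules_def)
  show "fully_invariant R M K" using duo Ks by (simp add: duo_def)
  show "K \<noteq> {\<zero>\<^bsub>M\<^esub>}" by fact
  fix X Y
  assume XY: "fully_invariant R M X \<and> fully_invariant R M Y \<and> K \<subseteq> coprod R M X Y"
  then have X: "submodule X R M" by (simp add: fully_invariant_def)
  show "K \<subseteq> X \<or> K \<subseteq> Y"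
  proof (cases "K \<subseteq> X")
    case False
    then have "X \<inter> K = {\<zero>\<^bsub>M\<^esub>}" using simple_disjoint_or_subset[OF K X] by blast
    then obtain f where f: "f \<in> End_mod R M" "\<And>x. x \<in> X \<Longrightarrow> f x = \<zero>\<^bsub>M\<^esub>"
        "\<And>k. k \<in> K \<Longrightarrow> f k = k"
      using self_injective_extends_projection[OF inj X Ks] by metis
    then have "f \<in> An R M X" by (simp add: An_def)
    then have "f k \<in> Y" if "k \<in> K" for k
      using XY that unfolding coprod_def by blast
    then show ?thesis using f(3) by auto
  qed simp
qed

lemma submodule_Union_chain:
  assumes "\<And>L. L \<in> \<C> \<Longrightarrow> submodule L R M" "\<C> \<noteq> {}" "chain\<^sub>\<subseteq> \<C>"
  shows "submodule (\<Union>\<C>) R M"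
proof -
  have "x \<oplus>\<^bsub>M\<^esub> y \<in> \<Union>\<C>" if "x \<in> \<Union>\<C>" "y \<in> \<Union>\<C>" for x y
  proof -
    obtain L where "L \<in> \<C>" "x \<in> L" "y \<in> L"
      using \<open>x \<in> \<Union>\<C>\<close> \<open>y \<in> \<Union>\<C>\<close> \<open>chain\<^sub>\<subseteq> \<C>\<close> unfolding chain_subset_def by blast
    then show ?thesis using assms(1) submodule_iff by blast
  qed
  moreover have "\<Union>\<C> \<subseteq> carrier M" "\<zero>\<^bsub>M\<^esub> \<in> \<Union>\<C>" "\<forall>x\<in>\<Union>\<C>. \<ominus>\<^bsub>M\<^esub> x \<in> \<Union>\<C>"
    "\<forall>a\<in>carrier R. \<forall>x\<in>\<Union>\<C>. a \<odot>\<^bsub>M\<^esub> x \<in> \<Union>\<C>"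
    using assms(1,2) unfolding submodule_iff by blast+
  ultimately show ?thesis unfolding submodule_iff by blast
qed

text \<open>
  In a self-injective duo module distinct simple submodules are not isomorphic, so \<open>K\<close> does not
  lie in the sum of the others. Taking \<open>L\<close> maximal with \<open>L \<inter> K = 0\<close> instead of that sum avoids
  finite sums of simple submodules: the two-summand module \<open>L \<oplus> S\<close> is all that is needed.
\<close>

lemma simple_excluded_by_submodule:
  assumes inj: "self_injective R M" and duo: "duo R M" and K: "K \<in> simple_submodules R M"
  obtains L where "submodule L R M" "\<not> K \<subseteq> L"
    "\<And>S. S \<in> simple_submodules R M \<Longrightarrow> S \<noteq> K \<Longrightarrow> S \<subseteq> L"
proof -
  have Ks: "submodule K R M" "K \<noteq> {\<zero>\<^bsub>M\<^esub>}" using K by (auto simp: simple_submodules_def)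
  define \<A> where "\<A> = {L. submodule L R M \<and> L \<inter> K = {\<zero>\<^bsub>M\<^esub>}}"
  have "\<exists>L\<in>\<A>. \<forall>X\<in>\<A>. L \<subseteq> X \<longrightarrow> X = L"
  proof (rule subset_Zorn_nonempty)
    have "{\<zero>\<^bsub>M\<^esub>} \<inter> K = {\<zero>\<^bsub>M\<^esub>}" using Ks(1) unfolding submodule_iff by blast
    then have "{\<zero>\<^bsub>M\<^esub>} \<in> \<A>" using submodule_zero by (simp add: \<A>_def)
    then show "\<A> \<noteq> {}" by blast
  next
    fix \<C> assume C: "\<C> \<noteq> {}" "subset.chain \<A> \<C>"
    have elem: "submodule L R M" "L \<inter> K = {\<zero>\<^bsub>M\<^esub>}" if "L \<in> \<C>" for L
      using C(2) that by (auto simp: \<A>_def subset_chain_def)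
    have "chain\<^sub>\<subseteq> \<C>"
      using C(2) unfolding subset_chain_def chain_subset_def by blast
    then have "submodule (\<Union>\<C>) R M"
      using submodule_Union_chain elem(1) C(1) by blast
    moreover have "\<Union>\<C> \<inter> K = {\<zero>\<^bsub>M\<^esub>}"
      using elem(2) C(1) by blast
    ultimately show "\<Union>\<C> \<in> \<A>" by (simp add: \<A>_def)
  qed
  then obtain L where "L \<in> \<A>" and max_\<A>: "\<forall>X\<in>\<A>. L \<subseteq> X \<longrightarrow> X = L" ..
  then have L: "submodule L R M" and LK: "L \<inter> K = {\<zero>\<^bsub>M\<^esub>}"
    by (simp_all add: \<A>_def)
  have max: "X = L" if "submodule X R M" "X \<inter> K = {\<zero>\<^bsub>M\<^esub>}" "L \<subseteq> X" for X
    using max_\<A> that by (simp add: \<A>_def)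
  have notKL: "\<not> K \<subseteq> L" using LK Ks by blast
  have "S \<subseteq> L" if S: "S \<in> simple_submodules R M" "S \<noteq> K" for S
  proof (rule ccontr)
    assume "\<not> S \<subseteq> L"
    have Ss: "submodule S R M" using S by (simp add: simple_submodules_def)
    have LS: "L \<inter> S = {\<zero>\<^bsub>M\<^esub>}"
      using simple_disjoint_or_subset[OF S(1) L] \<open>\<not> S \<subseteq> L\<close> by blast
    \<comment> \<open>By maximality of \<open>L\<close>, the strictly larger sum cannot meet \<open>K\<close> trivially.\<close>
    have "K \<subseteq> L <+>\<^bsub>M\<^esub> S"
      using simple_disjoint_or_subset[OF K submodule_set_add[OF L Ss]]
        max[OF submodule_set_add[OF L Ss]] subset_set_add[OF L Ss] \<open>\<not> S \<subseteq> L\<close> by blast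
    have KS: "S \<inter> K = {\<zero>\<^bsub>M\<^esub>}"
      using simple_disjoint_or_subset[OF K Ss] S Ks by (auto simp: simple_submodules_def)
    obtain f where f: "f \<in> End_mod R M" "\<And>l s. l \<in> L \<Longrightarrow> s \<in> S \<Longrightarrow> f (l \<oplus>\<^bsub>M\<^esub> s) = s"
      using self_injective_extends_projection[OF inj L Ss LS] by metis
    have "k \<in> L" if "k \<in> K" for k
    proof -
      obtain l s where ls: "l \<in> L" "s \<in> S" "k = l \<oplus>\<^bsub>M\<^esub> s"
        using \<open>K \<subseteq> L <+>\<^bsub>M\<^esub> S\<close> \<open>k \<in> K\<close> by (auto simp: set_add_def')
      \<comment> \<open>The projection onto \<open>S\<close> kills \<open>k\<close>: its value \<open>s\<close> lies in \<open>S\<close>, and in \<open>K\<close> because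
        \<open>M\<close> is duo.\<close>
      have "f k \<in> K"
        using duo Ks f(1) \<open>k \<in> K\<close> by (auto simp: duo_def fully_invariant_def)
      then have "s = \<zero>\<^bsub>M\<^esub>" using f(2) ls KS by auto
      moreover have "l \<in> carrier M" using ls L by (auto simp: submodule_iff)
      ultimately show ?thesis using ls by simp
    qed
    with notKL show False by blast
  qed
  then show ?thesis by (rule that[OF L notKL])
qed

lemma Spec_fc_topology_discrete:
  assumes inj: "self_injective R M" and duo: "duo R M"
    and simple: "Spec_fc R M \<subseteq> simple_submodules R M"
  shows "Spec_fc_topology R M = discrete_topology (simple_submodules R M)"
proof -
  have Spec: "Spec_fc R M = simple_submodules R M"
    using simple simple_fully_coprime[OF inj duo] by (auto simp: Spec_fc_def)
  have "openin (Spec_fc_topology R M) {K}" if K: "K \<in> simple_submodules R M" for K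
  proof -
    obtain L where "submodule L R M" "\<not> K \<subseteq> L"
      "\<And>S. S \<in> simple_submodules R M \<Longrightarrow> S \<noteq> K \<Longrightarrow> S \<subseteq> L"
      by (rule simple_excluded_by_submodule[OF inj duo K]) blast
    then have "{K} = Spec_fc R M - V_fc R M L"
      using K by (auto simp: Spec V_fc_def)
    then show ?thesis
      using \<open>submodule L R M\<close> unfolding openin_Spec_fc_topology[OF duo] by blast
  qed
  then show ?thesis
    using topspace_Spec_fc_topology[OF duo] Spec
    by (metis discrete_topology_unique)
qed

end

theorem theorem3p33:
  fixes R :: "('r, 'a) ring_scheme" and M :: "('r, 'm, 'b) module_scheme"
  assumes "left_module R M"
    and "carrier M \<noteq> {\<zero>\<^bsub>M\<^esub>}"
    and "S_IAD R M"
    and "\<And>K. submodule K R M \<Longrightarrow> fully_coprime R M K \<Longrightarrow> K \<in> simple_submodules R M"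
  shows "(Lindelof_space (Spec_fc_topology R M) \<longleftrightarrow> countable (simple_submodules R M)) \<and>
         (compact_space (Spec_fc_topology R M) \<longleftrightarrow> finite (simple_submodules R M))"
proof -
  have "Spec_fc R M \<subseteq> simple_submodules R M"
    using assms(4) by (auto simp: Spec_fc_def fully_coprime_def fully_invariant_def)
  then have "Spec_fc_topology R M = discrete_topology (simple_submodules R M)"
    using assms(1,3) by (intro left_module.Spec_fc_topology_discrete) (auto simp: S_IAD_def)
  then show ?thesis
    by (simp add: Lindelof_space_discrete_topology compact_space_discrete_topology)
qed

end
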